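(* Let $r \geq 2$, let $G$ be a connected $r$-graph with at least one edge, and let $1 < p < \infty$. Then, for any nonnegative principal eigenvector $\mathbf{x}$ of $G$ (for the exponent $p$), $$\gamma(G,\mathbf{x}) \geq \left(\frac{\Delta(G)}{\delta(G)}\right)^{\frac{1}{p+r-2}}.$$
   Context: An $r$-graph $G$ is a finite simple $r$-uniform hypergraph with vertex set $V(G)$ and edge set $E(G) \subseteq \binom{V(G)}{r}$. It is connected if $V(G)$ cannot be partitioned into two nonempty sets such that every edge is contained in one of them. The degree $\deg v$ is the number of edges containing $v$; $\Delta(G) = \max_v \deg v$ and $\delta(G) = \min_v \deg v$. For $\mathbf{x} \in \mathbb{R}^{V(G)}$ put $L_G(\mathbf{x}) = r! \sum_{e \in E(G)} \prod_{v \in e} x_v$, and $\rho_p(G) = \sup\{L_G(\mathbf{x}) : \|\mathbf{x}\|_p = 1\}$. A nonnegative principal eigenvector of $G$ (for $p$) is a vector $\mathbf{x}$ with $\|\mathbf{x}\|_p = 1$, $x_v \geq 0$ for all $v$, and $L_G(\mathbf{x}) = \rho_p(G)$. The principal ratio is $\gamma(G,\mathbf{x}) = \sup_{u,v \in V(G)} x_u/x_v$ if all $x_v > 0$, and $\gamma(G,\mathbf{x}) = \infty$ if some $x_v = 0$. *)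

theory Defs
  imports "HOL-Analysis.Analysis" "HOL-Library.Ramsey"
begin

text \<open>
  A hypergraph is given by its vertex set \<open>V\<close> and edge set \<open>E\<close>.
  Vectors indexed by \<open>V\<close> are functions on the whole vertex type, of which only the
  values on \<open>V\<close> are ever used.
\<close>

definition r_graph :: "nat \<Rightarrow> 'a set \<Rightarrow> 'a set set \<Rightarrow> bool" where
  "r_graph r V E \<longleftrightarrow> finite V \<and> E \<subseteq> nsets V r"

definition connected_hypergraph :: "'a set \<Rightarrow> 'a set set \<Rightarrow> bool" where
  "connected_hypergraph V E \<longleftrightarrow>
     \<not> (\<exists>A B. A \<noteq> {} \<and> B \<noteq> {} \<and> A \<inter> B = {} \<and> A \<union> B = V \<and>
            (\<forall>e\<in>E. e \<subseteq> A \<or> e \<subseteq> B))"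

definition degree :: "'a set set \<Rightarrow> 'a \<Rightarrow> nat" where
  "degree E v = card {e \<in> E. v \<in> e}"

definition max_degree :: "'a set \<Rightarrow> 'a set set \<Rightarrow> nat" where
  "max_degree V E = Max (degree E ` V)"

definition min_degree :: "'a set \<Rightarrow> 'a set set \<Rightarrow> nat" where
  "min_degree V E = Min (degree E ` V)"

definition edge_form :: "nat \<Rightarrow> 'a set set \<Rightarrow> ('a \<Rightarrow> real) \<Rightarrow> real" where
  "edge_form r E x = fact r * (\<Sum>e\<in>E. \<Prod>v\<in>e. x v)"

definition p_norm :: "real \<Rightarrow> 'a set \<Rightarrow> ('a \<Rightarrow> real) \<Rightarrow> real" where
  "p_norm p V x = (\<Sum>v\<in>V. \<bar>x v\<bar> powr p) powr (1 / p)"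

text \<open>
  For \<open>V\<close> finite and nonempty and \<open>p > 0\<close> the supremum is over a nonempty bounded set,
  since then \<open>p_norm p V x = 1\<close> is attainable and forces \<open>\<bar>x v\<bar> \<le> 1\<close> on \<open>V\<close>.
\<close>

definition p_spectral_radius :: "nat \<Rightarrow> real \<Rightarrow> 'a set \<Rightarrow> 'a set set \<Rightarrow> real" where
  "p_spectral_radius r p V E = Sup {edge_form r E x | x. p_norm p V x = 1}"

definition nonneg_principal_eigenvector ::
    "nat \<Rightarrow> real \<Rightarrow> 'a set \<Rightarrow> 'a set set \<Rightarrow> ('a \<Rightarrow> real) \<Rightarrow> bool" where
  "nonneg_principal_eigenvector r p V E x \<longleftrightarrow>
     p_norm p V x = 1 \<and> (\<forall>v\<in>V. x v \<ge> 0) \<and> edge_form r E x = p_spectral_radius r p V E"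

definition principal_ratio :: "'a set \<Rightarrow> ('a \<Rightarrow> real) \<Rightarrow> ereal" where
  "principal_ratio V x =
     (if \<forall>v\<in>V. x v > 0 then SUP (u, v)\<in>V \<times> V. ereal (x u / x v) else \<infinity>)"

end

theory Submission
  imports Defs
begin

text \<open>
  Only the case of a strictly positive \<open>x\<close> has content. There the Lagrange condition for
  maximising \<open>edge_form r E\<close> on the unit sphere of the \<open>p\<close>-norm is the eigenvector equation
  \<open>fact (r - 1) * link_sum E x w = \<rho> * x w powr (p - 1)\<close> at every vertex \<open>w\<close>, with \<open>\<rho>\<close> the
  spectral radius. Let \<open>m\<close> and \<open>M\<close> be the least and the greatest entry of \<open>x\<close>.
  Since \<open>link_sum E x w\<close> is a sum of \<open>degree E w\<close> products of \<open>r - 1\<close> entries, it lies between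
  \<open>degree E w * m ^ (r - 1)\<close> and \<open>degree E w * M ^ (r - 1)\<close>. Reading the equation at a vertex of
  maximum degree and at one of minimum degree gives, up to the factor \<open>fact (r - 1)\<close>,
  \<^item> \<open>\<Delta> * m ^ (r - 1) \<le> \<rho> * M powr (p - 1)\<close> and
  \<^item> \<open>\<rho> * m powr (p - 1) \<le> \<delta> * M ^ (r - 1)\<close>.

  Eliminating \<open>\<rho>\<close> yields \<open>\<Delta> * m powr (p + r - 2) \<le> \<delta> * M powr (p + r - 2)\<close>, and \<open>M / m\<close> is one
  of the ratios in the supremum that defines \<open>principal_ratio\<close>.

  The eigenvector equation is obtained by varying one coordinate at a time: homogeneity turns
  the definition of \<open>\<rho>\<close> into \<open>edge_form r E y \<le> \<rho> * p_norm p V y ^ r\<close> for all nonzero \<open>y\<close>, with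
  equality at \<open>x\<close>, so the difference of the two sides has a critical point at \<open>x\<close>.
\<close>

section \<open>Homogeneity and the variational bound\<close>

lemma r_graph_edge:
  assumes "r_graph r V E" "e \<in> E"
  shows "e \<subseteq> V" "finite e" "card e = r"
  using assms by (auto simp: r_graph_def nsets_def)

lemma r_graph_finite_edges: "r_graph r V E \<Longrightarrow> finite E"
  unfolding r_graph_def using finite_imp_finite_nsets finite_subset by blast

lemma edge_form_scale:
  assumes "r_graph r V E"
  shows "edge_form r E (\<lambda>v. c * x v) = c ^ r * edge_form r E x"
proof -
  have "(\<Prod>v\<in>e. c * x v) = c ^ r * (\<Prod>v\<in>e. x v)" if "e \<in> E" for e
    using r_graph_edge[OF assms that] by (simp add: prod.distrib)
  then show ?thesis
    by (simp add: edge_form_def sum_distrib_left mult_ac)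
qed

lemma p_norm_scale:
  assumes "p > 0" "c \<ge> 0"
  shows "p_norm p V (\<lambda>v. c * x v) = c * p_norm p V x"
proof -
  have "(\<Sum>v\<in>V. \<bar>c * x v\<bar> powr p) = c powr p * (\<Sum>v\<in>V. \<bar>x v\<bar> powr p)"
    using assms by (simp add: abs_mult powr_mult sum_distrib_left)
  then show ?thesis
    using assms by (simp add: p_norm_def powr_mult powr_powr sum_nonneg)
qed

lemma p_norm_eq_1_iff:
  assumes "p > 0"
  shows "p_norm p V x = 1 \<longleftrightarrow> (\<Sum>v\<in>V. \<bar>x v\<bar> powr p) = 1"
proof
  assume "p_norm p V x = 1"
  then have "((\<Sum>v\<in>V. \<bar>x v\<bar> powr p) powr (1 / p)) powr p = 1"
    by (simp add: p_norm_def)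
  then show "(\<Sum>v\<in>V. \<bar>x v\<bar> powr p) = 1"
    using assms by (simp add: powr_powr sum_nonneg)
qed (simp add: p_norm_def)

lemma abs_le_1_if_p_norm_1:
  assumes "finite V" "p > 0" "p_norm p V x = 1" "v \<in> V"
  shows "\<bar>x v\<bar> \<le> 1"
proof (rule ccontr)
  assume "\<not> \<bar>x v\<bar> \<le> 1"
  then have "1 < \<bar>x v\<bar> powr p"
    using assms by simp
  also have "\<dots> \<le> (\<Sum>v\<in>V. \<bar>x v\<bar> powr p)"
    using assms by (intro member_le_sum) auto
  finally show False
    using assms p_norm_eq_1_iff[of p V x] by simp
qed

lemma edge_form_le_radius_if_p_norm_1:
  assumes "r_graph r V E" "p > 0" "p_norm p V y = 1"
  shows "edge_form r E y \<le> p_spectral_radius r p V E"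
  unfolding p_spectral_radius_def
proof (rule cSup_upper)
  show "edge_form r E y \<in> {edge_form r E x | x. p_norm p V x = 1}"
    using assms by blast
  have "edge_form r E x \<le> fact r * card E" if "p_norm p V x = 1" for x
  proof -
    have "(\<Prod>v\<in>e. x v) \<le> 1" if "e \<in> E" for e
    proof -
      have "(\<Prod>v\<in>e. x v) \<le> (\<Prod>v\<in>e. \<bar>x v\<bar>)"
        using abs_ge_self[of "\<Prod>v\<in>e. x v"] by (simp add: abs_prod)
      also have "\<dots> \<le> 1"
        using r_graph_edge[OF assms(1) \<open>e \<in> E\<close>] assms \<open>p_norm p V x = 1\<close>
        by (intro prod_le_1) (auto simp: r_graph_def intro: abs_le_1_if_p_norm_1)
      finally show ?thesis .
    qed
    then have "(\<Sum>e\<in>E. \<Prod>v\<in>e. x v) \<le> card E"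
      using sum_bounded_above[of E "\<lambda>e. \<Prod>v\<in>e. x v" 1] by simp
    then show ?thesis
      by (simp add: edge_form_def)
  qed
  then show "bdd_above {edge_form r E x | x. p_norm p V x = 1}"
    by (auto simp: bdd_above_def)
qed

lemma edge_form_le_radius:
  assumes "r_graph r V E" "p > 0" "p_norm p V y > 0"
  shows "edge_form r E y \<le> p_spectral_radius r p V E * p_norm p V y ^ r"
proof -
  define c where "c = p_norm p V y"
  have "c > 0" using assms by (simp add: c_def)
  have "inverse c ^ r * edge_form r E y \<le> p_spectral_radius r p V E"
    using edge_form_le_radius_if_p_norm_1[of r V E p "\<lambda>v. inverse c * y v"]
      edge_form_scale[of r V E "inverse c" y] p_norm_scale[of p "inverse c" V y] assms \<open>c > 0\<close>
    by (simp add: c_def)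
  then show ?thesis
    using \<open>c > 0\<close> by (simp add: c_def[symmetric] field_simps)
qed

section \<open>The eigenvector equation\<close>

text \<open>The partial derivative of \<open>\<Sum>e\<in>E. \<Prod>v\<in>e. x v\<close> with respect to the variable at \<open>w\<close>.\<close>

definition link_sum :: "'a set set \<Rightarrow> ('a \<Rightarrow> real) \<Rightarrow> 'a \<Rightarrow> real" where
  "link_sum E x w = (\<Sum>e\<in>{e \<in> E. w \<in> e}. \<Prod>v\<in>e - {w}. x v)"

lemma edge_form_upd:
  assumes "r_graph r V E"
  shows "edge_form r E (x(w := x w + t)) = edge_form r E x + t * (fact r * link_sum E x w)"
proof -
  have "(\<Prod>v\<in>e. (x(w := x w + t)) v) =
      (\<Prod>v\<in>e. x v) + (if w \<in> e then t * (\<Prod>v\<in>e - {w}. x v) else 0)" if "e \<in> E" for e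
  proof (cases "w \<in> e")
    case True
    have "(\<Prod>v\<in>e - {w}. (x(w := x w + t)) v) = (\<Prod>v\<in>e - {w}. x v)"
      by (intro prod.cong) auto
    then show ?thesis
      using True r_graph_edge(2)[OF assms that]
      by (simp add: prod.remove[of e w] algebra_simps)
  next
    case False
    have "(\<Prod>v\<in>e. (x(w := x w + t)) v) = (\<Prod>v\<in>e. x v)"
      using False by (intro prod.cong) auto
    then show ?thesis using False by simp
  qed
  then have "(\<Sum>e\<in>E. \<Prod>v\<in>e. (x(w := x w + t)) v) =
      (\<Sum>e\<in>E. (\<Prod>v\<in>e. x v) + (if w \<in> e then t * (\<Prod>v\<in>e - {w}. x v) else 0))"
    by (rule sum.cong[OF refl])
  also have "\<dots> = (\<Sum>e\<in>E. \<Prod>v\<in>e. x v) + t * link_sum E x w"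
    using r_graph_finite_edges[OF assms]
    by (simp add: sum.distrib link_sum_def sum_distrib_left sum.inter_filter if_distrib[of "(*) t"]
        cong: if_cong)
  finally show ?thesis
    by (simp only: edge_form_def) (simp add: algebra_simps)
qed

lemma p_norm_upd:
  assumes "finite V" "p > 0" "p_norm p V x = 1" "w \<in> V" "x w > 0" "\<bar>t\<bar> < x w"
  shows "p_norm p V (x(w := x w + t)) = (1 + (x w + t) powr p - x w powr p) powr (1 / p)"
    and "1 + (x w + t) powr p - x w powr p > 0"
proof -
  have rest: "(\<Sum>v\<in>V - {w}. \<bar>(x(w := x w + t)) v\<bar> powr p) = (\<Sum>v\<in>V - {w}. \<bar>x v\<bar> powr p)"
    by (intro sum.cong) auto
  have 1: "x w powr p + (\<Sum>v\<in>V - {w}. \<bar>x v\<bar> powr p) = 1"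
    using assms p_norm_eq_1_iff[of p V x] by (simp add: sum.remove[of V w])
  have "(\<Sum>v\<in>V. \<bar>(x(w := x w + t)) v\<bar> powr p) =
      (x w + t) powr p + (\<Sum>v\<in>V - {w}. \<bar>x v\<bar> powr p)"
    using assms rest by (simp add: sum.remove[of V w])
  also have "\<dots> = 1 + (x w + t) powr p - x w powr p"
    using 1 by linarith
  finally show "p_norm p V (x(w := x w + t)) = (1 + (x w + t) powr p - x w powr p) powr (1 / p)"
    by (simp only: p_norm_def)
  have "(\<Sum>v\<in>V - {w}. \<bar>x v\<bar> powr p) \<ge> 0"
    by (intro sum_nonneg) auto
  moreover have "(x w + t) powr p > 0"
    using assms by simp
  ultimately show "1 + (x w + t) powr p - x w powr p > 0"
    using 1 by linarith
qed

text \<open>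
  Moving the coordinate at \<open>w\<close> by \<open>t\<close> changes \<open>edge_form\<close> affinely, and changes the \<open>r\<close>-th power
  of the norm to \<open>(1 + (x w + t) powr p - x w powr p) powr (r / p)\<close>, which has derivative
  \<open>r * x w powr (p - 1)\<close> at \<open>t = 0\<close>. By \<open>edge_form_le_radius\<close> the difference \<open>?f\<close> below has a local
  maximum there. Positivity of \<open>x w\<close> keeps the moved coordinate positive, so that the absolute
  value in the norm can be dropped.
\<close>

lemma eigenvector_equation:
  assumes "r \<ge> 1" "r_graph r V E" "p > 0" "p_norm p V x = 1"
    and max: "edge_form r E x = p_spectral_radius r p V E"
    and "w \<in> V" "x w > 0"
  shows "fact (r - 1) * link_sum E x w = p_spectral_radius r p V E * x w powr (p - 1)"
proof -
  define \<rho> where "\<rho> = p_spectral_radius r p V E"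
  let ?N = "\<lambda>t. 1 + (x w + t) powr p - x w powr p"
  let ?f = "\<lambda>t. (edge_form r E x + t * (fact r * link_sum E x w)) - \<rho> * ?N t powr (r / p)"
  have "finite V"
    using assms by (simp add: r_graph_def)
  have "?f t \<le> ?f 0" if "\<bar>0 - t\<bar> < x w" for t
  proof -
    note N = p_norm_upd[OF \<open>finite V\<close> \<open>p > 0\<close> \<open>p_norm p V x = 1\<close> \<open>w \<in> V\<close> \<open>x w > 0\<close>, of t]
    have "p_norm p V (x(w := x w + t)) ^ r = ?N t powr (r / p)"
      using N that by (simp add: powr_power)
    moreover have "edge_form r E (x(w := x w + t)) \<le> \<rho> * p_norm p V (x(w := x w + t)) ^ r"
      unfolding \<rho>_def using N that assms by (intro edge_form_le_radius) auto
    ultimately have "?f t \<le> 0"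
      by (simp add: edge_form_upd[OF \<open>r_graph r V E\<close>])
    also have "0 = ?f 0"
      using max by (simp add: \<rho>_def)
    finally show ?thesis .
  qed
  moreover have "(?f has_real_derivative
      fact r * link_sum E x w - \<rho> * (r / p * (p * x w powr (p - 1)))) (at 0)"
    using \<open>x w > 0\<close> \<open>p > 0\<close> by (auto intro!: derivative_eq_intros)
  ultimately have "fact r * link_sum E x w - \<rho> * (r / p * (p * x w powr (p - 1))) = 0"
    using \<open>x w > 0\<close> by (intro DERIV_local_max) auto
  then have "real r * (fact (r - 1) * link_sum E x w) = real r * (\<rho> * x w powr (p - 1))"
    using \<open>p > 0\<close> fact_reduce[of r, where 'a = real] \<open>r \<ge> 1\<close> by (simp add: mult_ac)
  then show ?thesis
    using \<open>r \<ge> 1\<close> by (simp add: \<rho>_def)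
qed

section \<open>Comparing the extreme degrees\<close>

lemma link_sum_bounds:
  fixes m M :: real
  assumes "r_graph r V E" "m \<ge> 0" "\<And>v. v \<in> V \<Longrightarrow> m \<le> x v" "\<And>v. v \<in> V \<Longrightarrow> x v \<le> M"
  shows "degree E w * m ^ (r - 1) \<le> link_sum E x w"
    and "link_sum E x w \<le> degree E w * M ^ (r - 1)"
proof -
  have prod_bounds: "m ^ (r - 1) \<le> (\<Prod>v\<in>e - {w}. x v) \<and> (\<Prod>v\<in>e - {w}. x v) \<le> M ^ (r - 1)"
    if "e \<in> E" "w \<in> e" for e
  proof -
    have card: "card (e - {w}) = r - 1"
      using r_graph_edge[OF assms(1) \<open>e \<in> E\<close>] \<open>w \<in> e\<close> by simp
    have "e - {w} \<subseteq> V"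
      using r_graph_edge[OF assms(1) \<open>e \<in> E\<close>] by blast
    then have "(\<Prod>v\<in>e - {w}. m) \<le> (\<Prod>v\<in>e - {w}. x v)" "(\<Prod>v\<in>e - {w}. x v) \<le> (\<Prod>v\<in>e - {w}. M)"
      using assms(2-4) by (auto simp del: prod_constant intro!: prod_mono intro: order_trans)
    then show ?thesis
      by (simp add: card)
  qed
  show "degree E w * m ^ (r - 1) \<le> link_sum E x w"
    unfolding link_sum_def degree_def using prod_bounds
    by (intro sum_bounded_below) auto
  show "link_sum E x w \<le> degree E w * M ^ (r - 1)"
    unfolding link_sum_def degree_def using prod_bounds
    by (intro sum_bounded_above) auto
qed

lemma degree_bound_of_eigenvector:
  assumes "r \<ge> 1" "r_graph r V E" "p \<ge> 1"
    and eig: "nonneg_principal_eigenvector r p V E x"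
    and "m > 0" and lower: "\<And>v. v \<in> V \<Longrightarrow> m \<le> x v" and upper: "\<And>v. v \<in> V \<Longrightarrow> x v \<le> M"
    and "u \<in> V" "w \<in> V"
  shows "degree E u * m powr (p + real r - 2) \<le> degree E w * M powr (p + real r - 2)"
proof -
  define \<rho> where "\<rho> = p_spectral_radius r p V E"
  have pos: "x v > 0" if "v \<in> V" for v
    using lower[OF that] \<open>m > 0\<close> by linarith
  have "M > 0"
    using pos[OF \<open>u \<in> V\<close>] upper[OF \<open>u \<in> V\<close>] by linarith
  have equation: "fact (r - 1) * link_sum E x v = \<rho> * x v powr (p - 1)" if "v \<in> V" for v
    unfolding \<rho>_def
    using assms pos[OF that] that
    by (intro eigenvector_equation) (auto simp: nonneg_principal_eigenvector_def)
  have "\<rho> \<ge> 0"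
  proof -
    have "x v \<ge> 0" if "e \<in> E" "v \<in> e" for e v
      using r_graph_edge(1)[OF assms(2) \<open>e \<in> E\<close>] pos[of v] that by auto
    then have "edge_form r E x \<ge> 0"
      by (auto simp: edge_form_def intro!: mult_nonneg_nonneg sum_nonneg prod_nonneg)
    then show ?thesis
      using eig by (simp add: \<rho>_def nonneg_principal_eigenvector_def)
  qed
  have "fact (r - 1) * (degree E u * m ^ (r - 1)) \<le> \<rho> * x u powr (p - 1)"
    using link_sum_bounds(1)[of r V E m x M u] assms equation[OF \<open>u \<in> V\<close>]
    by (metis fact_ge_zero less_imp_le mult_left_mono)
  also have "\<dots> \<le> \<rho> * M powr (p - 1)"
    using \<open>\<rho> \<ge> 0\<close> pos[OF \<open>u \<in> V\<close>] upper[OF \<open>u \<in> V\<close>] \<open>p \<ge> 1\<close>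
    by (intro mult_left_mono powr_mono2) auto
  finally have u_bound: "fact (r - 1) * (degree E u * m ^ (r - 1)) \<le> \<rho> * M powr (p - 1)" .
  have "\<rho> * m powr (p - 1) \<le> \<rho> * x w powr (p - 1)"
    using \<open>\<rho> \<ge> 0\<close> \<open>m > 0\<close> lower[OF \<open>w \<in> V\<close>] \<open>p \<ge> 1\<close>
    by (intro mult_left_mono powr_mono2) auto
  also have "\<dots> \<le> fact (r - 1) * (degree E w * M ^ (r - 1))"
    using link_sum_bounds(2)[of r V E m x M w] assms equation[OF \<open>w \<in> V\<close>]
    by (metis fact_ge_zero less_imp_le mult_left_mono)
  finally have w_bound: "\<rho> * m powr (p - 1) \<le> fact (r - 1) * (degree E w * M ^ (r - 1))" .
  have split_powr: "a powr (p + real r - 2) = a ^ (r - 1) * a powr (p - 1)" if "a > 0" for a :: real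
    using that \<open>r \<ge> 1\<close> by (simp add: powr_realpow[symmetric] powr_add[symmetric] of_nat_diff add.commute)
  have "fact (r - 1) * (degree E u * m powr (p + real r - 2)) =
      (fact (r - 1) * (degree E u * m ^ (r - 1))) * m powr (p - 1)"
    by (simp add: split_powr[OF \<open>m > 0\<close>])
  also have "\<dots> \<le> (\<rho> * M powr (p - 1)) * m powr (p - 1)"
    by (intro mult_right_mono u_bound) simp
  also have "\<dots> = (\<rho> * m powr (p - 1)) * M powr (p - 1)"
    by simp
  also have "\<dots> \<le> (fact (r - 1) * (degree E w * M ^ (r - 1))) * M powr (p - 1)"
    by (intro mult_right_mono w_bound) simp
  also have "\<dots> = fact (r - 1) * (degree E w * M powr (p + real r - 2))"
    by (simp add: split_powr[OF \<open>M > 0\<close>])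
  finally show ?thesis
    by simp
qed

theorem theorem1p4:
  fixes r :: nat and p :: real
    and V :: "'a set" and E :: "'a set set" and x :: "'a \<Rightarrow> real"
  assumes "r \<ge> 2"
    and "r_graph r V E"
    and "connected_hypergraph V E"
    and "E \<noteq> {}"
    and "1 < p"
    and "nonneg_principal_eigenvector r p V E x"
  shows "principal_ratio V x \<ge>
           ereal ((real (max_degree V E) / real (min_degree V E)) powr (1 / (p + real r - 2)))"
proof (cases "\<forall>v\<in>V. x v > 0")
  case False
  then have "principal_ratio V x = \<infinity>"
    by (simp only: principal_ratio_def if_False)
  then show ?thesis
    by simp
next
  case True
  have "finite V"
    using assms by (simp add: r_graph_def)
  have "V \<noteq> {}"
  proof -
    obtain e where "e \<in> E" using \<open>E \<noteq> {}\<close> by blast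
    with r_graph_edge[OF assms(2) this] \<open>r \<ge> 2\<close> show ?thesis by auto
  qed
  obtain u where u: "u \<in> V" "max_degree V E = degree E u"
    using Max_in[of "degree E ` V"] \<open>finite V\<close> \<open>V \<noteq> {}\<close>
    unfolding max_degree_def by (metis finite_imageI image_is_empty imageE)
  obtain w where w: "w \<in> V" "min_degree V E = degree E w"
    using Min_in[of "degree E ` V"] \<open>finite V\<close> \<open>V \<noteq> {}\<close>
    unfolding min_degree_def by (metis finite_imageI image_is_empty imageE)
  obtain a where a: "a \<in> V" "\<And>v. v \<in> V \<Longrightarrow> x v \<le> x a"
    using Max_in[of "x ` V"] Max_ge[of "x ` V"] \<open>finite V\<close> \<open>V \<noteq> {}\<close> by fastforce
  obtain b where b: "b \<in> V" "\<And>v. v \<in> V \<Longrightarrow> x b \<le> x v"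
    using Min_in[of "x ` V"] Min_le[of "x ` V"] \<open>finite V\<close> \<open>V \<noteq> {}\<close> by fastforce
  have pos: "x a > 0" "x b > 0"
    using True a b by auto
  define q where "q = p + real r - 2"
  have "q > 0"
    using assms by (simp add: q_def)
  have "degree E u * x b powr q \<le> degree E w * x a powr q"
    unfolding q_def using assms pos a b u w
    by (intro degree_bound_of_eigenvector[where V = V and x = x]) auto
  then have "degree E u / degree E w \<le> x a powr q / x b powr q"
    \<comment> \<open>If \<open>degree E w = 0\<close>, the left-hand quotient is \<open>0\<close> by the convention on division.\<close>
    using pos by (cases "degree E w = 0") (simp_all add: field_simps)
  then have "degree E u / degree E w \<le> (x a / x b) powr q"
    using pos by (simp add: powr_divide)
  then have "(degree E u / degree E w) powr (1 / q) \<le> ((x a / x b) powr q) powr (1 / q)"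
    using \<open>q > 0\<close> by (intro powr_mono2) auto
  also have "\<dots> = x a / x b"
    using \<open>q > 0\<close> pos by (simp add: powr_powr)
  finally have "ereal ((degree E u / degree E w) powr (1 / q)) \<le> ereal (x a / x b)"
    by simp
  also have "\<dots> \<le> (SUP (u, v)\<in>V \<times> V. ereal (x u / x v))"
    using a b by (intro SUP_upper2[of "(a, b)"]) auto
  also have "\<dots> = principal_ratio V x"
    using True by (simp add: principal_ratio_def)
  finally show ?thesis
    by (simp add: u w q_def)
qed

end
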